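(* Every series-parallel graph is partially DP-nice.
   Context: All graphs are nonempty, finite and simple. For $m\in\mathbb{N}=\{1,2,\dots\}$ write $[m]=\{1,\dots,m\}$. Series-parallel graphs are the graphs with treewidth at most 2. Here the treewidth $tw(G)$ equals $\omega(M)-1$, where $M$ is a chordal graph obtained by adding edges to $G$ (on the same vertex set) with smallest possible clique number $\omega(M)$. For $S,U\subseteq V(H)$, $E_H(S,U)$ is the set of edges of $H$ with at least one endpoint in $S$ and at least one endpoint in $U$. A cover of a graph $G$ is a pair $\mathcal{H}=(L,H)$ where $H$ is a graph and $L:V(G)\to\mathcal{P}(V(H))$ satisfies: (1) the sets $L(u)$, $u\in V(G)$, partition $V(H)$; (2) $H[L(u)]$ is complete for every $u\in V(G)$; (3) for every $uv\in E(G)$, $E_H(L(u),L(v))$ is a (possibly empty) matching; (4) if $u\neq v$ and $uv\notin E(G)$, then $E_H(L(u),L(v))=\emptyset$. The cover is $m$-fold if $|L(u)|=m$ for all $u\in V(G)$. An $\mathcal{H}$-coloring of $G$ is an independent set of size $|V(G)|$ in $H$. The DP-chromatic number $\chi_{DP}(G)$ is the smallest $m$ such that $G$ has an $\mathcal{H}$-coloring for every $m$-fold cover $\mathcal{H}$ of $G$. For $t\in\mathbb{N}$, the partial DP $t$-chromatic number $\alpha_t^{DP}(G)$ is the minimum of $\alpha(H)$ (the independence number of $H$) over all $t$-fold covers $\mathcal{H}=(L,H)$ of $G$. A graph $G$ is partially DP-nice if $\alpha_t^{DP}(G)\ge t|V(G)|/\chi_{DP}(G)$ for all $t\in[\chi_{DP}(G)]$.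 *)

theory Defs
  imports Complex_Main "HOL-Library.Disjoint_Sets"
begin

record 'a ugraph =
  verts :: "'a set"
  edges :: "'a set set"

definition simple_graph :: "'a ugraph \<Rightarrow> bool" where
  "simple_graph G \<longleftrightarrow>
     finite (verts G) \<and> verts G \<noteq> {} \<and> (\<forall>e\<in>edges G. e \<subseteq> verts G \<and> card e = 2)"

definition adjacent :: "'a ugraph \<Rightarrow> 'a \<Rightarrow> 'a \<Rightarrow> bool" where
  "adjacent G u v \<longleftrightarrow> {u, v} \<in> edges G"

definition complete_on :: "'a ugraph \<Rightarrow> 'a set \<Rightarrow> bool" where
  "complete_on G S \<longleftrightarrow> S \<subseteq> verts G \<and> (\<forall>u\<in>S. \<forall>v\<in>S. u \<noteq> v \<longrightarrow> adjacent G u v)"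

definition clique_number :: "'a ugraph \<Rightarrow> nat" where
  "clique_number G = Max {card S | S. complete_on G S}"

definition independent_set :: "'a ugraph \<Rightarrow> 'a set \<Rightarrow> bool" where
  "independent_set G S \<longleftrightarrow> S \<subseteq> verts G \<and> (\<forall>u\<in>S. \<forall>v\<in>S. \<not> adjacent G u v)"

definition independence_number :: "'a ugraph \<Rightarrow> nat" where
  "independence_number G = Max {card S | S. independent_set G S}"

definition cycle_in :: "'a ugraph \<Rightarrow> 'a list \<Rightarrow> bool" where
  "cycle_in G xs \<longleftrightarrow>
     length xs \<ge> 3 \<and> distinct xs \<and> set xs \<subseteq> verts G \<and>
     (\<forall>i<length xs. adjacent G (xs ! i) (xs ! (Suc i mod length xs)))"

definition has_chord :: "'a ugraph \<Rightarrow> 'a list \<Rightarrow> bool" where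
  "has_chord G xs \<longleftrightarrow>
     (\<exists>i<length xs. \<exists>j<length xs. adjacent G (xs ! i) (xs ! j) \<and>
        j \<noteq> Suc i mod length xs \<and> i \<noteq> Suc j mod length xs)"

definition chordal :: "'a ugraph \<Rightarrow> bool" where
  "chordal G \<longleftrightarrow> (\<forall>xs. cycle_in G xs \<and> length xs \<ge> 4 \<longrightarrow> has_chord G xs)"

definition chordal_completion :: "'a ugraph \<Rightarrow> 'a ugraph \<Rightarrow> bool" where
  "chordal_completion G M \<longleftrightarrow>
     simple_graph M \<and> chordal M \<and> verts M = verts G \<and> edges G \<subseteq> edges M"

text \<open>The truncated subtraction is harmless: nonempty graphs have clique number at least 1.\<close>

definition treewidth :: "'a ugraph \<Rightarrow> nat" where
  "treewidth G = (LEAST k. \<exists>M. chordal_completion G M \<and> clique_number M = k) - 1"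

definition series_parallel :: "'a ugraph \<Rightarrow> bool" where
  "series_parallel G \<longleftrightarrow> treewidth G \<le> 2"

definition edges_between :: "'a ugraph \<Rightarrow> 'a set \<Rightarrow> 'a set \<Rightarrow> 'a set set" where
  "edges_between H S U = {e \<in> edges H. e \<inter> S \<noteq> {} \<and> e \<inter> U \<noteq> {}}"

definition is_matching :: "'a set set \<Rightarrow> bool" where
  "is_matching M \<longleftrightarrow> pairwise disjnt M"

definition is_cover :: "'a ugraph \<Rightarrow> ('a \<Rightarrow> 'b set) \<Rightarrow> 'b ugraph \<Rightarrow> bool" where
  "is_cover G L H \<longleftrightarrow>
     simple_graph H \<and>
     (\<Union>u\<in>verts G. L u) = verts H \<and> disjoint_family_on L (verts G) \<and>
     (\<forall>u\<in>verts G. complete_on H (L u)) \<and>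
     (\<forall>u\<in>verts G. \<forall>v\<in>verts G. adjacent G u v \<longrightarrow>
        is_matching (edges_between H (L u) (L v))) \<and>
     (\<forall>u\<in>verts G. \<forall>v\<in>verts G. u \<noteq> v \<and> \<not> adjacent G u v \<longrightarrow>
        edges_between H (L u) (L v) = {})"

definition is_fold_cover :: "nat \<Rightarrow> 'a ugraph \<Rightarrow> ('a \<Rightarrow> 'b set) \<Rightarrow> 'b ugraph \<Rightarrow> bool" where
  "is_fold_cover m G L H \<longleftrightarrow> is_cover G L H \<and> (\<forall>u\<in>verts G. card (L u) = m)"

definition is_cover_coloring :: "'a ugraph \<Rightarrow> 'b ugraph \<Rightarrow> 'b set \<Rightarrow> bool" where
  "is_cover_coloring G H I \<longleftrightarrow> independent_set H I \<and> card I = card (verts G)"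

text \<open>
  In the next two definitions the cover graphs have vertices in \<^typ>\<open>nat\<close>.
  This loses no generality: every cover graph is finite, hence isomorphic to one on
  natural numbers, and all properties involved are invariant under isomorphism.
  The bound \<open>1 \<le> m\<close> is needed because cover graphs are nonempty, so there is
  no 0-fold cover.
\<close>

definition dp_chromatic_number :: "'a ugraph \<Rightarrow> nat" where
  "dp_chromatic_number G =
     (LEAST m. 1 \<le> m \<and>
        (\<forall>(L :: 'a \<Rightarrow> nat set) H. is_fold_cover m G L H \<longrightarrow> (\<exists>I. is_cover_coloring G H I)))"

definition partial_dp_chromatic_number :: "nat \<Rightarrow> 'a ugraph \<Rightarrow> nat" where
  "partial_dp_chromatic_number t G =
     (LEAST k. \<exists>(L :: 'a \<Rightarrow> nat set) H. is_fold_cover t G L H \<and> independence_number H = k)"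

definition partially_dp_nice :: "'a ugraph \<Rightarrow> bool" where
  "partially_dp_nice G \<longleftrightarrow>
     (\<forall>t\<in>{1..dp_chromatic_number G}.
        real (partial_dp_chromatic_number t G)
          \<ge> real t * real (card (verts G)) / real (dp_chromatic_number G))"

end

theory Submission
  imports Defs "HOL-Library.Nat_Bijection"
begin

text \<open>
  Let \<open>M\<close> be a chordal completion of \<open>G\<close> without cliques on four vertices. Every nonempty set of
  vertices of \<open>M\<close> contains a vertex that is simplicial in the induced subgraph. Hence \<open>M\<close> has a
  proper 3-colouring, and any \<open>m\<close> of its colour classes induce a subgraph of \<open>G\<close> that is
  \<open>(m - 1)\<close>-degenerate, since the neighbourhood of a simplicial vertex together with that vertex is a
  clique. A greedy choice therefore colours any \<open>m\<close> classes from an \<open>m\<close>-fold cover. For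
  \<open>m = 3\<close> this bounds the DP-chromatic number by 3; for \<open>m = 2\<close> and the two largest classes it gives
  the case of 2-fold covers when the DP-chromatic number is 3. For 1-fold covers, the product of
  \<open>G\<close> with a complete graph on \<open>k\<close> vertices is a \<open>k\<close>-fold cover whose colourings are the proper
  \<open>k\<close>-colourings of \<open>G\<close>, and the largest colour class is independent.
\<close>

section \<open>Simplicial vertices of chordal graphs\<close>

lemma adjacent_sym: "adjacent G u v \<longleftrightarrow> adjacent G v u"
  by (simp add: adjacent_def insert_commute)

lemma adjacent_irrefl: "simple_graph G \<Longrightarrow> \<not> adjacent G u u"
  by (force simp: simple_graph_def adjacent_def)

lemma adjacent_verts:
  "simple_graph G \<Longrightarrow> adjacent G u v \<Longrightarrow> u \<in> verts G \<and> v \<in> verts G"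
  by (force simp: simple_graph_def adjacent_def)

text \<open>This is a walk with \<open>n\<close> edges: vertices may repeat, only the interior must
  lie in \<open>X\<close>, and values of \<open>f\<close> beyond \<open>n\<close> are arbitrary.
  Injectivity comes later from minimal length.\<close>

definition path_through :: "'a ugraph \<Rightarrow> 'a set \<Rightarrow> 'a \<Rightarrow> 'a \<Rightarrow> nat \<Rightarrow> (nat \<Rightarrow> 'a) \<Rightarrow> bool" where
  "path_through M X a b n f \<longleftrightarrow>
     f 0 = a \<and> f n = b \<and> (\<forall>i<n. adjacent M (f i) (f (Suc i))) \<and> (\<forall>i. 0 < i \<and> i < n \<longrightarrow> f i \<in> X)"

lemma path_through_exists:
  assumes "(x, y) \<in> {(u, v). adjacent M u v \<and> u \<in> X \<and> v \<in> X}\<^sup>*"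
    and "x \<in> X" "y \<in> X" "adjacent M a x" "adjacent M y b"
  shows "\<exists>n f. path_through M X a b n f"
proof -
  let ?r = "{(u, v). adjacent M u v \<and> u \<in> X \<and> v \<in> X}"
  obtain k where "(x, y) \<in> ?r ^^ k"
    using assms(1) rtrancl_imp_relpow by blast
  then obtain g where g: "g 0 = x" "g k = y" "\<forall>i<k. (g i, g (Suc i)) \<in> ?r"
    by (auto simp: relpow_fun_conv)
  have gX: "g i \<in> X" if "i \<le> k" for i
    using that g assms(2,3) by (cases "i = k") auto
  \<comment> \<open>The walk \<open>g\<close> is shifted by one index to make room for
    \<open>a\<close>, and \<open>b\<close> follows at index \<open>k + 2\<close>.\<close>
  define f where "f = (\<lambda>i. if i = 0 then a else if i \<le> Suc k then g (i - 1) else b)"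
  have "adjacent M (f i) (f (Suc i))" if i: "i < Suc (Suc k)" for i
  proof -
    consider "i = 0" | "i = Suc k" | j where "i = Suc j" "j < k"
      using i by (metis less_SucE less_Suc_eq_0_disj)
    then show ?thesis
      using g assms(4,5) by cases (auto simp: f_def)
  qed
  then have "path_through M X a b (Suc (Suc k)) f"
    using gX by (auto simp: path_through_def f_def)
  then show ?thesis by blast
qed

text \<open>The edge from \<open>f i\<close> to \<open>f j\<close> replaces the segment between
  them, which has at least one inner vertex. Hence a shortest walk has no chords.\<close>

lemma path_through_shortcut:
  assumes "path_through M X a b n f" "i < j" "j \<le> n" "Suc i \<noteq> j" "adjacent M (f i) (f j)"
  shows "\<exists>n' f'. n' < n \<and> path_through M X a b n' f'"
proof -
  define d where "d = j - Suc i"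
  define g where "g = (\<lambda>k. if k \<le> i then f k else f (k + d))"
  have d: "d > 0" "j = Suc i + d" using assms(2,4) by (auto simp: d_def)
  have "adjacent M (g k) (g (Suc k))" if "k < n - d" for k
  proof -
    consider "k < i" | "k = i" | "k > i" by linarith
    then show ?thesis
    proof cases
      case 1
      then show ?thesis using assms(1,3) d by (auto simp: g_def path_through_def)
    next
      case 2
      then show ?thesis using assms(5) d by (auto simp: g_def)
    next
      case 3
      then have "adjacent M (f (k + d)) (f (Suc (k + d)))"
        using assms(1) that by (auto simp: path_through_def)
      then show ?thesis using 3 by (auto simp: g_def)
    qed
  qed
  moreover have "g k \<in> X" if "0 < k" "k < n - d" for k
    using assms(1,3) d that by (auto simp: g_def path_through_def)
  moreover have "g 0 = a" "g (n - d) = b"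
    using assms(1,3) d by (auto simp: g_def path_through_def)
  ultimately have "path_through M X a b (n - d) g"
    by (auto simp: path_through_def)
  moreover have "n - d < n" using d assms(3) by auto
  ultimately show ?thesis by blast
qed

text \<open>Cutting out the closed segment between two visits to one vertex shortens the walk. Hence
  a shortest walk is injective.\<close>

lemma path_through_cut_loop:
  assumes "path_through M X a b n f" "i < j" "j \<le> n" "f i = f j"
  shows "\<exists>n' f'. n' < n \<and> path_through M X a b n' f'"
proof -
  define d where "d = j - i"
  define g where "g = (\<lambda>k. if k \<le> i then f k else f (k + d))"
  have d: "d > 0" "j = i + d" using assms(2) by (auto simp: d_def)
  have "adjacent M (g k) (g (Suc k))" if "k < n - d" for k
  proof -
    consider "k < i" | "k = i" | "k > i" by linarith
    then show ?thesis
    proof cases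
      case 1
      then show ?thesis using assms(1,3) d by (auto simp: g_def path_through_def)
    next
      case 2
      then have "adjacent M (f j) (f (Suc j))"
        using assms(1) that d by (auto simp: path_through_def)
      then show ?thesis using 2 d assms(4) by (auto simp: g_def)
    next
      case 3
      then have "adjacent M (f (k + d)) (f (Suc (k + d)))"
        using assms(1) that by (auto simp: path_through_def)
      then show ?thesis using 3 by (auto simp: g_def)
    qed
  qed
  moreover have "g k \<in> X" if "0 < k" "k < n - d" for k
    using assms(1,3) d that by (auto simp: g_def path_through_def)
  moreover have "g 0 = a" using assms(1) by (auto simp: g_def path_through_def)
  \<comment> \<open>If \<open>j = n\<close>, then \<open>n - d = i\<close> falls into the first
    branch of \<open>g\<close>, and the value is \<open>f i = f n = b\<close>.\<close>
  moreover have "g (n - d) = b"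
    using assms d by (cases "j = n") (auto simp: g_def path_through_def)
  ultimately have "path_through M X a b (n - d) g"
    by (auto simp: path_through_def)
  moreover have "n - d < n" using d assms(3) by auto
  ultimately show ?thesis by blast
qed

text \<open>A shortest \<open>a\<close>--\<open>b\<close> path through \<open>X\<close> would close up with \<open>y\<close> to a chordless cycle.\<close>

lemma chordal_boundary_adjacent:
  assumes M: "simple_graph M" "chordal M"
    and path: "path_through M X a b n f"
    and "X \<subseteq> verts M" "y \<notin> X" "\<And>x. x \<in> X \<Longrightarrow> \<not> adjacent M y x"
    and "a \<noteq> b" "adjacent M y a" "adjacent M y b"
  shows "adjacent M a b"
proof (rule ccontr)
  assume nadj: "\<not> adjacent M a b"
  define P where "P = (\<lambda>n. \<exists>f. path_through M X a b n f)"
  define l where "l = (LEAST n. P n)"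
  have "P n" using path by (auto simp: P_def)
  then have "P l" unfolding l_def by (rule LeastI)
  then obtain p where p: "path_through M X a b l p" by (auto simp: P_def)
  have least: "\<not> (\<exists>n' f'. n' < l \<and> path_through M X a b n' f')"
    using not_less_Least[of _ P] by (auto simp: l_def P_def)
  have p0: "p 0 = a" and pl: "p l = b"
    and padj: "\<And>i. i < l \<Longrightarrow> adjacent M (p i) (p (Suc i))"
    and pX: "\<And>i. 0 < i \<Longrightarrow> i < l \<Longrightarrow> p i \<in> X"
    using p by (auto simp: path_through_def)
  have "l \<noteq> 0" using p0 pl \<open>a \<noteq> b\<close> by metis
  moreover have "l \<noteq> 1" using p0 pl padj[of 0] nadj by auto
  \<comment> \<open>The walk thus has at least three vertices, so the cycle obtained by adding
    \<open>y\<close> has at least four, as chordality requires.\<close>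
  ultimately have l2: "l \<ge> 2" by linarith
  have chordless: "j = Suc i" if "i < j" "j \<le> l" "adjacent M (p i) (p j)" for i j
    using path_through_shortcut[OF p that(1,2) _ that(3)] least by metis
  have inj: "p i \<noteq> p j" if "i < j" "j \<le> l" for i j
    using path_through_cut_loop[OF p that] least by blast
  have yp: "p i \<noteq> y" if i: "i \<le> l" for i
  proof -
    consider "i = 0" | "i = l" | "0 < i" "i < l" using i by linarith
    then show ?thesis
      using p0 pl pX assms(5,8,9) adjacent_irrefl[OF M(1)] by cases auto
  qed
  have yadj: "i = 0 \<or> i = l" if "i \<le> l" "adjacent M y (p i)" for i
    using pX[of i] assms(6) that by (cases "0 < i \<and> i < l") auto
  have pV: "p i \<in> verts M" if i: "i \<le> l" for i
  proof -
    consider "i = 0" | "i = l" | "0 < i" "i < l" using i by linarith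
    then show ?thesis
      using p0 pl pX assms(4) adjacent_verts[OF M(1)] assms(8,9) by cases auto
  qed
  \<comment> \<open>The cycle runs along the shortest walk at indices \<open>0\<close> to
    \<open>l\<close> and returns through \<open>y\<close> at index \<open>l + 1\<close>.\<close>
  define h where "h = (\<lambda>i. if i \<le> l then p i else y)"
  define xs where "xs = map h [0..<l + 2]"
  have len: "length xs = l + 2" by (simp add: xs_def)
  have nth: "xs ! i = h i" if "i < l + 2" for i
    using that by (simp add: xs_def del: upt_Suc)
  have "inj_on h {0..<l + 2}"
    by (rule linorder_inj_onI') (use inj yp in \<open>auto simp: h_def\<close>)
  then have dist: "distinct xs"
    by (simp add: xs_def distinct_map del: upt_Suc)
  have "y \<in> verts M" using adjacent_verts[OF M(1) assms(8)] by simp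
  then have sub: "set xs \<subseteq> verts M"
    using pV by (auto simp: xs_def h_def simp del: upt_Suc)
  have cyc: "adjacent M (xs ! i) (xs ! (Suc i mod length xs))" if i: "i < length xs" for i
  proof -
    consider "i < l" | "i = l" | "i = Suc l" using i len by linarith
    then show ?thesis
    proof cases
      case 1
      then show ?thesis using padj by (simp add: len nth h_def)
    next
      case 2
      then show ?thesis using assms(9) pl adjacent_sym[of M y b] by (simp add: len nth h_def)
    next
      case 3
      then show ?thesis using assms(8) p0 by (simp add: len nth h_def)
    qed
  qed
  have "cycle_in M xs"
    using dist sub cyc l2 by (simp add: cycle_in_def len)
  moreover have "length xs \<ge> 4" using l2 len by simp
  ultimately have "has_chord M xs"
    using M(2) by (simp add: chordal_def)
  then obtain i j where ij: "i < l + 2" "j < l + 2" "adjacent M (h i) (h j)"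
      "j \<noteq> Suc i mod (l + 2)" "i \<noteq> Suc j mod (l + 2)"
    by (auto simp: has_chord_def len nth)
  \<comment> \<open>By symmetry \<open>i < j\<close> may be assumed. A chord either joins two walk
    vertices, against \<open>chordless\<close>, or ends in \<open>y\<close>, whose only neighbours
    on the walk are its two neighbours on the cycle.\<close>
  have no_chord: False
    if "i < j" "j < l + 2" "adjacent M (h i) (h j)"
      "j \<noteq> Suc i mod (l + 2)" "i \<noteq> Suc j mod (l + 2)" for i j
  proof (cases "j \<le> l")
    case True
    then show False using chordless[of i j] that by (auto simp: h_def)
  next
    case False
    then have "j = Suc l" using that by simp
    then have "i \<le> l" "adjacent M y (p i)" using that adjacent_sym[of M] by (auto simp: h_def)
    then show False using yadj[of i] that \<open>j = Suc l\<close> by auto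
  qed
  have "i \<noteq> j" using ij(3) adjacent_irrefl[OF M(1)] by auto
  then show False
    using no_chord[of i j] no_chord[of j i] ij adjacent_sym[of M "h i"] by (metis linorder_neqE_nat)
qed

text \<open>
  Take a maximal connected set \<open>X\<close> that does not dominate \<open>W\<close>. By maximality, each vertex of the
  boundary of \<open>X\<close> is adjacent to all of the undominated set \<open>Y\<close>; so a simplicial vertex of \<open>Y\<close> is
  simplicial in \<open>W\<close>, because the boundary is a clique by the preceding lemma.
\<close>

lemma chordal_simplicial:
  assumes M: "simple_graph M" "chordal M" and "W \<subseteq> verts M" "W \<noteq> {}"
  shows "\<exists>y\<in>W. complete_on M {u \<in> W. adjacent M y u}"
proof -
  have "finite W" using assms finite_subset by (auto simp: simple_graph_def)
  then show ?thesis using assms(3,4)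
  proof (induction W rule: finite_psubset_induct)
    case (psubset W)
    show ?case
    proof (cases "\<forall>u\<in>W. \<forall>v\<in>W. u \<noteq> v \<longrightarrow> adjacent M u v")
      case True
      then have "complete_on M {u \<in> W. adjacent M y u}" for y
        using psubset.prems(1) by (auto simp: complete_on_def)
      then show ?thesis using psubset.prems(2) by blast
    next
      case False
      then obtain x0 z0 where x0: "x0 \<in> W" "z0 \<in> W" "x0 \<noteq> z0" "\<not> adjacent M x0 z0" by blast
      define r where "r = (\<lambda>X. {(u, v). adjacent M u v \<and> u \<in> X \<and> v \<in> X})"
      define Y where "Y = (\<lambda>X. {z \<in> W. z \<notin> X \<and> (\<forall>x\<in>X. \<not> adjacent M z x)})"
      define Q where "Q = {X. X \<subseteq> W \<and> x0 \<in> X \<and> (\<forall>x\<in>X. (x0, x) \<in> (r X)\<^sup>*) \<and> Y X \<noteq> {}}"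
      \<comment> \<open>The vertex \<open>z0\<close> is undominated by \<open>{x0}\<close>.\<close>
      have "{x0} \<in> Q"
        using x0 adjacent_sym[of M x0] by (auto simp: Q_def Y_def)
      moreover have "finite Q"
        by (rule finite_subset[of _ "Pow W"]) (use psubset.hyps in \<open>auto simp: Q_def\<close>)
      ultimately obtain X where X: "X \<in> Q" and Xmax: "\<And>X'. X' \<in> Q \<Longrightarrow> X \<subseteq> X' \<Longrightarrow> X = X'"
        using finite_has_maximal[of Q] by blast
      have XW: "X \<subseteq> W" and x0X: "x0 \<in> X" and conn: "\<And>x. x \<in> X \<Longrightarrow> (x0, x) \<in> (r X)\<^sup>*"
        and Yne: "Y X \<noteq> {}" using X by (auto simp: Q_def)
      \<comment> \<open>Otherwise \<open>insert w X\<close> is still connected and leaves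
        \<open>z\<close> undominated, contradicting maximality of \<open>X\<close>.\<close>
      have boundary: "adjacent M z w"
        if w: "w \<in> W" "w \<notin> X" "x \<in> X" "adjacent M w x" and z: "z \<in> Y X" for w x z
      proof (rule ccontr)
        assume "\<not> adjacent M z w"
        moreover have "z \<noteq> w" using w z by (auto simp: Y_def)
        ultimately have "z \<in> Y (insert w X)" using z by (auto simp: Y_def)
        have mono: "(r X)\<^sup>* \<subseteq> (r (insert w X))\<^sup>*"
          by (rule rtrancl_mono) (auto simp: r_def)
        have "(x, w) \<in> r (insert w X)"
          using w adjacent_sym[of M w] by (auto simp: r_def)
        then have "(x0, w) \<in> (r (insert w X))\<^sup>*"
          using conn[OF w(3)] mono by (meson rtrancl.rtrancl_into_rtrancl subsetD)
        then have "insert w X \<in> Q"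
          using XW x0X conn mono w \<open>z \<in> Y (insert w X)\<close> by (auto simp: Q_def)
        then show False using Xmax[of "insert w X"] w by auto
      qed
      have "Y X \<subset> W" using x0X XW by (auto simp: Y_def)
      moreover have "Y X \<subseteq> verts M" using psubset.prems by (auto simp: Y_def)
      ultimately obtain y where y: "y \<in> Y X" "complete_on M {u \<in> Y X. adjacent M y u}"
        using psubset.IH[of "Y X"] Yne by blast
      have "adjacent M u v"
        if u: "u \<in> W" "adjacent M y u" and v: "v \<in> W" "adjacent M y v" and "u \<noteq> v" for u v
      proof -
        \<comment> \<open>A neighbour of \<open>y\<close> lies outside \<open>X\<close> because
          \<open>y\<close> has no neighbour in \<open>X\<close>; so it is undominated or on the
          boundary.\<close>
        have bd: "w \<in> Y X \<or> (w \<notin> X \<and> (\<exists>x\<in>X. adjacent M w x))" if "w \<in> W" "adjacent M y w" for w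
          using that y(1) by (auto simp: Y_def)
        consider "u \<in> Y X" "v \<in> Y X"
          | x where "u \<notin> X" "x \<in> X" "adjacent M u x" "v \<in> Y X"
          | x where "v \<notin> X" "x \<in> X" "adjacent M v x" "u \<in> Y X"
          | x x' where "x \<in> X" "adjacent M u x" "x' \<in> X" "adjacent M v x'"
          using bd[OF u] bd[OF v] by blast
        then show ?thesis
        proof cases
          case 1
          then show ?thesis using y(2) u v \<open>u \<noteq> v\<close> by (auto simp: complete_on_def)
        next
          case 2
          then show ?thesis using boundary u adjacent_sym[of M u v] by blast
        next
          case 3
          then show ?thesis using boundary v by blast
        next
          \<comment> \<open>Two boundary vertices are joined by a walk through the connected set
            \<open>X\<close>, and \<open>y\<close> sees both of them but nothing in
            \<open>X\<close>.\<close>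
          case 4
          have "sym ((r X)\<^sup>*)"
            by (rule sym_rtrancl) (use adjacent_sym[of M] in \<open>auto simp: sym_def r_def\<close>)
          then have "(x, x') \<in> (r X)\<^sup>*"
            using conn[OF 4(1)] conn[OF 4(3)] by (meson rtrancl_trans symD)
          then obtain n f where "path_through M X u v n f"
            using path_through_exists[of x x' M X u v] 4 adjacent_sym[of M v] by (auto simp: r_def)
          then show ?thesis
            using chordal_boundary_adjacent[OF M, of X u v n f y] y(1) XW psubset.prems u v \<open>u \<noteq> v\<close>
            by (auto simp: Y_def)
        qed
      qed
      then have "complete_on M {u \<in> W. adjacent M y u}"
        using psubset.prems by (auto simp: complete_on_def)
      moreover have "y \<in> W" using y by (auto simp: Y_def)
      ultimately show ?thesis by blast
    qed
  qed
qed

section \<open>Colourings of chordal graphs\<close>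

lemma complete_on_insert_nbrs:
  assumes "complete_on M {u \<in> W. adjacent M y u}" "y \<in> W" "W \<subseteq> verts M"
  shows "complete_on M (insert y {u \<in> W. adjacent M y u})"
  using assms adjacent_sym[of M] unfolding complete_on_def by blast

lemma card_clique_le:
  assumes "simple_graph M" "complete_on M S"
  shows "card S \<le> clique_number M"
proof -
  have "finite {card S | S. complete_on M S}"
    by (rule finite_subset[of _ "card ` Pow (verts M)"])
      (use assms in \<open>auto simp: complete_on_def simple_graph_def\<close>)
  then show ?thesis
    using assms(2) by (auto simp: clique_number_def intro: Max_ge)
qed

text \<open>Remove a simplicial vertex and colour the rest. The vertex and its neighbours form a
  clique, so the neighbours leave one of the \<open>clique_number M\<close> colours free.\<close>

lemma chordal_coloring:
  assumes M: "simple_graph M" "chordal M" and "W \<subseteq> verts M"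
  shows "\<exists>c. (\<forall>u\<in>W. c u < clique_number M) \<and>
    (\<forall>u\<in>W. \<forall>v\<in>W. adjacent M u v \<longrightarrow> c u \<noteq> c v)"
proof -
  have "finite W" using assms finite_subset by (auto simp: simple_graph_def)
  then show ?thesis using assms(3)
  proof (induction W rule: finite_psubset_induct)
    case (psubset W)
    show ?case
    proof (cases "W = {}")
      case False
      then obtain y where y: "y \<in> W" "complete_on M {u \<in> W. adjacent M y u}"
        using chordal_simplicial[OF M psubset.prems] by blast
      let ?N = "{u \<in> W. adjacent M y u}"
      have "W - {y} \<subset> W" "W - {y} \<subseteq> verts M" using y(1) psubset.prems by auto
      then obtain c where c: "\<forall>u\<in>W - {y}. c u < clique_number M"
          "\<forall>u\<in>W - {y}. \<forall>v\<in>W - {y}. adjacent M u v \<longrightarrow> c u \<noteq> c v"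
        using psubset.IH[of "W - {y}"] by blast
      have fin: "finite ?N" using psubset.hyps by simp
      have "y \<notin> ?N" using adjacent_irrefl[OF M(1)] by simp
      then have "Suc (card ?N) \<le> clique_number M"
        using card_clique_le[OF M(1) complete_on_insert_nbrs[OF y(2,1) psubset.prems]] fin by simp
      moreover have "card (c ` ?N) \<le> card ?N" using fin by (rule card_image_le)
      ultimately have "\<not> {..<clique_number M} \<subseteq> c ` ?N"
        using card_mono[of "c ` ?N" "{..<clique_number M}"] fin by fastforce
      then obtain k where k: "k < clique_number M" "k \<notin> c ` ?N" by blast
      have "\<forall>u\<in>W. (c(y := k)) u < clique_number M" using c(1) k(1) by simp
      moreover have "\<forall>u\<in>W. \<forall>v\<in>W. adjacent M u v \<longrightarrow> (c(y := k)) u \<noteq> (c(y := k)) v"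
        using c(2) k(2) adjacent_irrefl[OF M(1)] adjacent_sym[of M] by auto
      ultimately show ?thesis by blast
    qed simp
  qed
qed

text \<open>A simplicial vertex of \<open>T\<close> and its neighbours form a clique, on which
  \<open>c\<close> is injective; this clique has at most \<open>card C\<close> vertices, one of them
  not a neighbour.\<close>

lemma chordal_colored_low_degree:
  assumes M: "simple_graph M" "chordal M" and T: "T \<subseteq> verts M" "T \<noteq> {}"
    and c: "\<And>u v. u \<in> T \<Longrightarrow> v \<in> T \<Longrightarrow> adjacent M u v \<Longrightarrow> c u \<noteq> c v"
    and C: "c ` T \<subseteq> C" "finite C"
  shows "\<exists>y\<in>T. card {u \<in> T. adjacent M y u} < card C"
proof -
  obtain y where y: "y \<in> T" "complete_on M {u \<in> T. adjacent M y u}"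
    using chordal_simplicial[OF M T] by blast
  let ?N = "{u \<in> T. adjacent M y u}"
  have "finite T" using M T finite_subset by (auto simp: simple_graph_def)
  then have fin: "finite ?N" by simp
  have "inj_on c (insert y ?N)"
    using complete_on_insert_nbrs[OF y(2,1) T(1)] c y(1)
    unfolding complete_on_def inj_on_def by blast
  then have "card (insert y ?N) \<le> card C"
    using C y(1) by (intro card_inj_on_le[where f = c]) auto
  moreover have "y \<notin> ?N" using adjacent_irrefl[OF M(1)] by simp
  ultimately show ?thesis using y(1) fin by (intro bexI[of _ y]) auto
qed

section \<open>Greedy colourings of covers\<close>

lemma card_independent_le:
  assumes "simple_graph H" "independent_set H S"
  shows "card S \<le> independence_number H"
proof -
  have "finite {card S | S. independent_set H S}"
    by (rule finite_subset[of _ "card ` Pow (verts H)"])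
      (use assms in \<open>auto simp: independent_set_def simple_graph_def\<close>)
  then show ?thesis
    using assms(2) by (auto simp: independence_number_def intro: Max_ge)
qed

text \<open>Distinct edges of a matching cannot share the endpoint \<open>z\<close>. Thus a chosen
  vertex blocks at most one element of each neighbouring list.\<close>

lemma cover_adjacent_unique:
  assumes cov: "is_cover G L H"
    and uv: "u \<in> verts G" "v \<in> verts G" "adjacent G u v"
    and x: "x \<in> L u" "x' \<in> L u" "z \<in> L v" "adjacent H x z" "adjacent H x' z"
  shows "x = x'"
proof (rule ccontr)
  assume "x \<noteq> x'"
  have "x \<noteq> z" using adjacent_irrefl[of H] cov x(4) by (auto simp: is_cover_def)
  then have "{x, z} \<noteq> {x', z}" using \<open>x \<noteq> x'\<close> by auto
  moreover have "{x, z} \<in> edges_between H (L u) (L v)" "{x', z} \<in> edges_between H (L u) (L v)"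
    using x by (auto simp: edges_between_def adjacent_def)
  moreover have "is_matching (edges_between H (L u) (L v))"
    using cov uv by (simp add: is_cover_def)
  ultimately have "disjnt {x, z} {x', z}"
    unfolding is_matching_def by (meson pairwiseD)
  then show False by (simp add: disjnt_def)
qed

lemma cover_adjacent:
  assumes "is_cover G L H" "u \<in> verts G" "v \<in> verts G" "u \<noteq> v"
    and "x \<in> L u" "z \<in> L v" "adjacent H x z"
  shows "adjacent G u v"
proof (rule ccontr)
  assume "\<not> adjacent G u v"
  then have "edges_between H (L u) (L v) = {}"
    using assms(1-4) by (auto simp: is_cover_def)
  moreover have "{x, z} \<in> edges_between H (L u) (L v)"
    using assms(5-7) by (auto simp: edges_between_def adjacent_def)
  ultimately show False by blast
qed

text \<open>Set aside a vertex with fewer than \<open>m\<close> neighbours in \<open>S\<close> and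
  choose for the rest first. Each neighbour blocks at most one of the \<open>m\<close> elements of
  its list, so one stays available.\<close>

lemma degenerate_greedy_choice:
  assumes G: "simple_graph G" and cov: "is_fold_cover m G L H" and "S \<subseteq> verts G"
    and "\<And>T. T \<subseteq> S \<Longrightarrow> T \<noteq> {} \<Longrightarrow> \<exists>y\<in>T. card {u \<in> T. adjacent G y u} < m"
  shows "\<exists>f. (\<forall>u\<in>S. f u \<in> L u) \<and> (\<forall>u\<in>S. \<forall>v\<in>S. \<not> adjacent H (f u) (f v))"
proof -
  have cov': "is_cover G L H" and fold: "\<And>u. u \<in> verts G \<Longrightarrow> card (L u) = m"
    using cov by (auto simp: is_fold_cover_def)
  have H: "simple_graph H" using cov' by (simp add: is_cover_def)
  have "finite S" using assms finite_subset by (auto simp: simple_graph_def)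
  then show ?thesis using assms(3,4)
  proof (induction S rule: finite_psubset_induct)
    case (psubset S)
    show ?case
    proof (cases "S = {}")
      case False
      then obtain y where y: "y \<in> S" "card {u \<in> S. adjacent G y u} < m"
        using psubset.prems(2)[of S] by blast
      let ?N = "{u \<in> S. adjacent G y u}"
      have yG: "y \<in> verts G" using y psubset.prems by auto
      have "S - {y} \<subset> S" "S - {y} \<subseteq> verts G" using y psubset.prems by auto
      moreover have "\<exists>y\<in>T. card {u \<in> T. adjacent G y u} < m" if "T \<subseteq> S - {y}" "T \<noteq> {}" for T
        using psubset.prems(2) that by blast
      ultimately obtain f where f: "\<forall>u\<in>S - {y}. f u \<in> L u"
          "\<forall>u\<in>S - {y}. \<forall>v\<in>S - {y}. \<not> adjacent H (f u) (f v)"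
        using psubset.IH[of "S - {y}"] by blast
      \<comment> \<open>\<open>B\<close> collects the blocked elements of \<open>L y\<close>;
        \<open>g\<close> below sends each to a neighbour of \<open>y\<close> that blocks it,
        injectively by the matching condition.\<close>
      define B where "B = {x \<in> L y. \<exists>u\<in>S - {y}. adjacent H x (f u)}"
      have "\<exists>u. u \<in> ?N \<and> u \<noteq> y \<and> adjacent H x (f u)" if "x \<in> B" for x
        using that f(1) cover_adjacent[OF cov' yG] psubset.prems(1) by (fastforce simp: B_def)
      then obtain g where g: "\<And>x. x \<in> B \<Longrightarrow> g x \<in> ?N \<and> g x \<noteq> y \<and> adjacent H x (f (g x))"
        by metis
      have "inj_on g B"
      proof (rule inj_onI)
        fix x x' assume xx: "x \<in> B" "x' \<in> B" "g x = g x'"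
        have "g x \<in> verts G" "f (g x) \<in> L (g x)"
          using g[OF xx(1)] f(1) psubset.prems(1) by auto
        then show "x = x'"
          using cover_adjacent_unique[OF cov' yG, of "g x" x x' "f (g x)"] g[OF xx(1)] g[OF xx(2)] xx
          by (auto simp: B_def)
      qed
      then have "card B \<le> card ?N"
        using g psubset.hyps by (intro card_inj_on_le[of g]) auto
      then have "card B < card (L y)" using y(2) fold[OF yG] by simp
      then have "B \<noteq> L y" by auto
      then obtain x where x: "x \<in> L y" "\<forall>u\<in>S - {y}. \<not> adjacent H x (f u)"
        by (auto simp: B_def)
      have "\<forall>u\<in>S. (f(y := x)) u \<in> L u" using f(1) x(1) by simp
      moreover have "\<forall>u\<in>S. \<forall>v\<in>S. \<not> adjacent H ((f(y := x)) u) ((f(y := x)) v)"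
        using f(2) x(2) adjacent_irrefl[OF H] adjacent_sym[of H] by auto
      ultimately show ?thesis by blast
    qed simp
  qed
qed

lemma degenerate_independent_set:
  assumes G: "simple_graph G" and cov: "is_fold_cover m G L H" and S: "S \<subseteq> verts G"
    and "\<And>T. T \<subseteq> S \<Longrightarrow> T \<noteq> {} \<Longrightarrow> \<exists>y\<in>T. card {u \<in> T. adjacent G y u} < m"
  shows "\<exists>I. independent_set H I \<and> card I = card S"
proof -
  obtain f where f: "\<forall>u\<in>S. f u \<in> L u" "\<forall>u\<in>S. \<forall>v\<in>S. \<not> adjacent H (f u) (f v)"
    using degenerate_greedy_choice[OF assms] by blast
  have "(\<Union>u\<in>verts G. L u) = verts H" and disj: "disjoint_family_on L (verts G)"
    using cov by (auto simp: is_fold_cover_def is_cover_def)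
  then have "f ` S \<subseteq> verts H" using f(1) S by blast
  moreover have "inj_on f S"
  proof (rule inj_onI, rule ccontr)
    fix u v assume "u \<in> S" "v \<in> S" "f u = f v" "u \<noteq> v"
    then have "f u \<in> L u \<inter> L v" "L u \<inter> L v = {}"
      using f(1) S disjoint_family_onD[OF disj, of u v] by auto
    then show False by simp
  qed
  ultimately show ?thesis
    using f(2) by (intro exI[of _ "f ` S"]) (auto simp: independent_set_def card_image)
qed

section \<open>Product covers\<close>

text \<open>The witness is the Cartesian product of \<open>G\<close> with a complete graph. It shows
  that \<open>k\<close>-fold covers exist, so minima over them are attained, and that proper
  colourings with \<open>dp_chromatic_number G\<close> colours exist.\<close>

lemma product_cover_exists:
  fixes G :: "'a ugraph"
  assumes G: "simple_graph G" and "1 \<le> k"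
  shows "\<exists>(L :: 'a \<Rightarrow> nat set) H. is_fold_cover k G L H \<and>
    (\<forall>I. is_cover_coloring G H I \<longrightarrow>
      (\<exists>c. (\<forall>u\<in>verts G. c u < k) \<and> (\<forall>u v. adjacent G u v \<longrightarrow> c u \<noteq> c v)))"
proof -
  have finV: "finite (verts G)" "verts G \<noteq> {}" using G by (auto simp: simple_graph_def)
  then obtain e :: "'a \<Rightarrow> nat" where e: "inj_on e (verts G)"
    using finite_imp_inj_to_nat_seg by metis
  \<comment> \<open>The pair of \<open>u\<close> and \<open>i\<close> is coded as a number because
    cover graphs here have vertices in \<open>nat\<close>.\<close>
  define p where "p = (\<lambda>u i. prod_encode (e u, i))"
  have p_eq: "p u i = p v j \<longleftrightarrow> u = v \<and> i = j" if "u \<in> verts G" "v \<in> verts G" for u v i j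
    using e that by (auto simp: p_def inj_on_def)
  define L where "L = (\<lambda>u. p u ` {..<k})"
  define E where "E = {{p u i, p v j} | u v i j. u \<in> verts G \<and> v \<in> verts G \<and> i < k \<and> j < k \<and>
     (u = v \<and> i \<noteq> j \<or> adjacent G u v \<and> i = j)}"
  define H where "H = \<lparr>verts = (\<Union>u\<in>verts G. L u), edges = E\<rparr>"
  have adjH: "adjacent H (p u i) (p v j) \<longleftrightarrow> u = v \<and> i \<noteq> j \<or> adjacent G u v \<and> i = j"
    if "u \<in> verts G" "v \<in> verts G" "i < k" "j < k" for u v i j
  proof
    assume "adjacent H (p u i) (p v j)"
    then obtain u' v' i' j' where *: "{p u i, p v j} = {p u' i', p v' j'}"
      "u' \<in> verts G" "v' \<in> verts G" "u' = v' \<and> i' \<noteq> j' \<or> adjacent G u' v' \<and> i' = j'"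
      by (auto simp: adjacent_def H_def E_def)
    then show "u = v \<and> i \<noteq> j \<or> adjacent G u v \<and> i = j"
      using that adjacent_sym[of G] by (auto simp: doubleton_eq_iff p_eq)
  qed (use that in \<open>auto simp: adjacent_def H_def E_def\<close>)
  have edge: "\<exists>u v i j. b = {p u i, p v j} \<and> u \<in> verts G \<and> v \<in> verts G \<and> i < k \<and> j < k \<and>
     (u = v \<and> i \<noteq> j \<or> adjacent G u v \<and> i = j)" if "b \<in> edges H" for b
    using that by (simp add: H_def E_def)
  have "b \<subseteq> verts H \<and> card b = 2" if bH: "b \<in> edges H" for b
  proof -
    obtain u v i j where b: "b = {p u i, p v j}" "u \<in> verts G" "v \<in> verts G" "i < k" "j < k"
      "u = v \<and> i \<noteq> j \<or> adjacent G u v \<and> i = j"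
      using edge[OF bH] by blast
    then have "p u i \<noteq> p v j" using adjacent_irrefl[OF G] p_eq by auto
    then show ?thesis using b by (auto simp: H_def L_def)
  qed
  moreover have "finite (verts H)" "verts H \<noteq> {}"
    using finV \<open>1 \<le> k\<close> by (auto simp: H_def L_def lessThan_empty_iff)
  ultimately have H: "simple_graph H" by (simp add: simple_graph_def)
  have union: "(\<Union>u\<in>verts G. L u) = verts H" by (simp add: H_def)
  have disj: "disjoint_family_on L (verts G)"
    by (auto simp: disjoint_family_on_def L_def p_eq)
  have compl: "complete_on H (L u)" if "u \<in> verts G" for u
    using that by (auto simp: complete_on_def adjH L_def) (auto simp: H_def L_def)
  \<comment> \<open>Edges between different lists join copies with equal index, which gives the
    matching.\<close>
  have between: "\<exists>i<k. b = {p u i, p v i} \<and> adjacent G u v"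
    if uv: "u \<in> verts G" "v \<in> verts G" "u \<noteq> v" and b: "b \<in> edges_between H (L u) (L v)" for u v b
  proof -
    obtain u' v' i' j' where *: "b = {p u' i', p v' j'}" "u' \<in> verts G" "v' \<in> verts G"
      "i' < k" "j' < k" "u' = v' \<and> i' \<noteq> j' \<or> adjacent G u' v' \<and> i' = j'"
      using b edge[of b] by (auto simp: edges_between_def)
    have "u = u' \<or> u = v'" "v = u' \<or> v = v'"
      using b * uv by (auto simp: edges_between_def L_def p_eq)
    then show ?thesis using * uv(3) adjacent_sym[of G] by (auto simp: insert_commute)
  qed
  have match: "is_matching (edges_between H (L u) (L v))"
    if "u \<in> verts G" "v \<in> verts G" "adjacent G u v" for u v
  proof -
    have "u \<noteq> v" using that adjacent_irrefl[OF G] by auto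
    have "disjnt b b'" if bb: "b \<in> edges_between H (L u) (L v)" "b' \<in> edges_between H (L u) (L v)"
      "b \<noteq> b'" for b b'
    proof -
      obtain i i' where "b = {p u i, p v i}" "b' = {p u i', p v i'}"
        using between[of u v b] between[of u v b'] bb \<open>u \<noteq> v\<close> that \<open>u \<in> verts G\<close> \<open>v \<in> verts G\<close> by blast
      then show ?thesis
        using bb(3) \<open>u \<noteq> v\<close> \<open>u \<in> verts G\<close> \<open>v \<in> verts G\<close> by (auto simp: disjnt_def p_eq)
    qed
    then show ?thesis by (auto simp: is_matching_def pairwise_def)
  qed
  have empty: "edges_between H (L u) (L v) = {}"
    if "u \<in> verts G" "v \<in> verts G" "u \<noteq> v" "\<not> adjacent G u v" for u v
    using between that by blast
  have "card (L u) = k" if "u \<in> verts G" for u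
    unfolding L_def using that by (subst card_image) (auto simp: inj_on_def p_eq)
  then have "is_fold_cover k G L H"
    using H union disj compl match empty by (auto simp: is_fold_cover_def is_cover_def)
  moreover have "\<exists>c. (\<forall>u\<in>verts G. c u < k) \<and> (\<forall>u v. adjacent G u v \<longrightarrow> c u \<noteq> c v)"
    if "is_cover_coloring G H I" for I
  proof -
    have I: "I \<subseteq> verts H" "\<And>x y. x \<in> I \<Longrightarrow> y \<in> I \<Longrightarrow> \<not> adjacent H x y" "card I = card (verts G)"
      using that by (auto simp: is_cover_coloring_def independent_set_def)
    \<comment> \<open>\<open>q\<close> maps a cover vertex to the vertex of \<open>G\<close> whose
      list contains it. Lists are cliques, so \<open>q\<close> is injective on the independent set
      \<open>I\<close>, and its size makes \<open>q\<close> onto \<open>verts G\<close>.\<close>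
    define q where "q = (\<lambda>x. THE u. u \<in> verts G \<and> x \<in> L u)"
    have q: "q x = u" if "u \<in> verts G" "x \<in> L u" for x u
      unfolding q_def using that by (intro the_equality) (auto simp: L_def p_eq)
    have qI: "q x \<in> verts G \<and> x \<in> L (q x)" if "x \<in> I" for x
      using that I(1) q union by blast
    have "inj_on q I"
    proof (rule inj_onI)
      fix x y assume "x \<in> I" "y \<in> I" "q x = q y"
      then show "x = y"
        using qI[of x] qI[of y] compl[of "q x"] I(2)[of x y] by (auto simp: complete_on_def)
    qed
    then have "card (q ` I) = card (verts G)" using I(3) by (simp add: card_image)
    then have "q ` I = verts G"
      using qI finV by (intro card_subset_eq) auto
    have "\<exists>i. i < k \<and> p u i \<in> I" if u: "u \<in> verts G" for u
    proof -
      have "u \<in> q ` I" using \<open>q ` I = verts G\<close> u by simp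
      then obtain x where "u = q x" "x \<in> I" by (rule imageE)
      then have "x \<in> L u" using qI by simp
      then show ?thesis using \<open>x \<in> I\<close> by (auto simp: L_def)
    qed
    then obtain c where c: "\<And>u. u \<in> verts G \<Longrightarrow> c u < k \<and> p u (c u) \<in> I" by metis
    have "c u \<noteq> c v" if "adjacent G u v" for u v
      using adjacent_verts[OF G that] I(2)[of "p u (c u)" "p v (c v)"] c[of u] c[of v] that
      by (auto simp: adjH)
    then show ?thesis using c by blast
  qed
  ultimately show ?thesis by blast
qed

lemma sum_color_classes:
  fixes c :: "'a \<Rightarrow> nat"
  assumes "finite V" "\<forall>u\<in>V. c u < k"
  shows "(\<Sum>i<k. card {u \<in> V. c u = i}) = card V"
proof -
  have "(\<Sum>i<k. card {u \<in> V. c u = i}) = card (\<Union>i\<in>{..<k}. {u \<in> V. c u = i})"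
    using assms(1) by (subst card_UN_disjoint) auto
  also have "(\<Union>i\<in>{..<k}. {u \<in> V. c u = i}) = V" using assms(2) by auto
  finally show ?thesis .
qed

section \<open>Series-parallel graphs\<close>

text \<open>The complete graph on \<open>verts G\<close> serves, so the minimum in
  \<open>treewidth\<close> ranges over a nonempty set.\<close>

lemma chordal_completion_exists:
  assumes G: "simple_graph G"
  shows "\<exists>M. chordal_completion G M"
proof -
  define M where "M = \<lparr>verts = verts G, edges = {e. e \<subseteq> verts G \<and> card e = 2}\<rparr>"
  have "has_chord M xs" if "cycle_in M xs" "length xs \<ge> 4" for xs
  proof -
    have xs: "distinct xs" "set xs \<subseteq> verts G"
      using that by (auto simp: cycle_in_def M_def)
    \<comment> \<open>Positions 0 and 2 are not consecutive on a cycle of length at least 4.\<close>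
    have "xs ! 0 \<noteq> xs ! 2" using xs that(2) by (subst nth_eq_iff_index_eq) auto
    moreover have "xs ! 0 \<in> verts G" "xs ! 2 \<in> verts G"
      using that(2) by (auto intro!: subsetD[OF xs(2)] nth_mem)
    ultimately have "adjacent M (xs ! 0) (xs ! 2)" by (simp add: adjacent_def M_def)
    then show ?thesis unfolding has_chord_def
      using that(2) by (intro exI[of _ 0] exI[of _ 2] conjI) auto
  qed
  then show ?thesis
    using G by (intro exI[of _ M])
      (auto simp: chordal_completion_def simple_graph_def chordal_def M_def)
qed

lemma series_parallel_completion:
  assumes "simple_graph G" "series_parallel G"
  shows "\<exists>M. chordal_completion G M \<and> clique_number M \<le> 3"
proof -
  let ?P = "\<lambda>k. \<exists>M. chordal_completion G M \<and> clique_number M = k"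
  have "\<exists>k. ?P k" using chordal_completion_exists[OF assms(1)] by blast
  then have "?P (LEAST k. ?P k)" by (rule LeastI_ex)
  then obtain M where "chordal_completion G M" "clique_number M = (LEAST k. ?P k)" by blast
  moreover have "(LEAST k. ?P k) \<le> 3"
    using assms(2) unfolding series_parallel_def treewidth_def by linarith
  ultimately show ?thesis by auto
qed

theorem corollary19:
  fixes G :: "'a ugraph"
  assumes "simple_graph G"
    and "series_parallel G"
  shows "partially_dp_nice G"
proof -
  let ?V = "verts G" and ?n = "card (verts G)"
  have finV: "finite ?V" using assms(1) by (simp add: simple_graph_def)
  obtain M where M: "simple_graph M" "chordal M" "verts M = ?V" "edges G \<subseteq> edges M"
      "clique_number M \<le> 3"
    using series_parallel_completion[OF assms] by (auto simp: chordal_completion_def)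
  have GM: "adjacent M u v" if "adjacent G u v" for u v
    using that M(4) by (auto simp: adjacent_def)
  obtain c where c: "\<forall>u\<in>?V. c u < (3::nat)"
      "\<And>u v. u \<in> ?V \<Longrightarrow> v \<in> ?V \<Longrightarrow> adjacent M u v \<Longrightarrow> c u \<noteq> c v"
  proof -
    obtain c where "\<forall>u\<in>?V. c u < clique_number M"
      "\<forall>u\<in>?V. \<forall>v\<in>?V. adjacent M u v \<longrightarrow> c u \<noteq> c v"
      using chordal_coloring[OF M(1,2), of ?V] M(3) by auto
    then show thesis using M(5) by (intro that[of c]) fastforce+
  qed
  \<comment> \<open>\<open>S\<close> lies in the union of the \<open>card C\<close> colour classes
    indexed by \<open>C\<close>. Low degrees in \<open>M\<close> carry over to its subgraph
    \<open>G\<close>.\<close>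
  have indep: "\<exists>I. independent_set H I \<and> card I = card S"
    if cov: "is_fold_cover (card C) G L H" and S: "S \<subseteq> ?V" and C: "c ` S \<subseteq> C" "finite C"
    for C L S and H :: "nat ugraph"
  proof (rule degenerate_independent_set[OF assms(1) cov S])
    fix T assume T: "T \<subseteq> S" "T \<noteq> {}"
    have "T \<subseteq> verts M" "c ` T \<subseteq> C" using T S C M(3) by auto
    then obtain y where y: "y \<in> T" "card {u \<in> T. adjacent M y u} < card C"
      using chordal_colored_low_degree[OF M(1,2) _ T(2) _ _ C(2), of c] c(2) M(3) by blast
    have "finite T" using T S finV by (meson finite_subset)
    then have "card {u \<in> T. adjacent G y u} \<le> card {u \<in> T. adjacent M y u}"
      using GM by (intro card_mono) auto
    then show "\<exists>y\<in>T. card {u \<in> T. adjacent G y u} < card C" using y by (meson le_less_trans)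
  qed
  define D where "D = (\<lambda>m. 1 \<le> m \<and>
      (\<forall>(L :: 'a \<Rightarrow> nat set) H. is_fold_cover m G L H \<longrightarrow> (\<exists>I. is_cover_coloring G H I)))"
  define \<chi> where "\<chi> = dp_chromatic_number G"
  have \<chi>_Least: "\<chi> = (LEAST m. D m)" by (simp add: \<chi>_def dp_chromatic_number_def D_def)
  have "D 3"
    using indep[of "{..<3}" _ _ ?V] c(1) by (auto simp: D_def is_cover_coloring_def)
  then have "D \<chi>" and "\<chi> \<le> 3" unfolding \<chi>_Least by (rule LeastI, rule Least_le)
  then have \<chi>1: "1 \<le> \<chi>" by (simp add: D_def)
  \<comment> \<open>This is the required inequality for a single cover, cleared of
    denominators.\<close>
  have bound: "t * ?n \<le> \<chi> * independence_number H"
    if t: "1 \<le> t" "t \<le> \<chi>" and cov: "is_fold_cover t G L H"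
    for t and L :: "'a \<Rightarrow> nat set" and H
  proof -
    have H: "simple_graph H" using cov by (simp add: is_fold_cover_def is_cover_def)
    have ge: "card S \<le> independence_number H"
      if "\<exists>I. independent_set H I \<and> card I = card S" for S :: "'a set"
      using that card_independent_le[OF H] by metis
    consider "t = \<chi>" | "t = 1" | "t = 2" "\<chi> = 3" using t \<open>\<chi> \<le> 3\<close> by linarith
    then show ?thesis
    proof cases
      case 1
      then have "?n \<le> independence_number H"
        using \<open>D \<chi>\<close> cov by (intro ge) (auto simp: D_def is_cover_coloring_def)
      then show ?thesis using 1 by simp
    next
      case 2
      \<comment> \<open>Applying \<open>D \<chi>\<close> to the product cover gives a proper
        colouring of \<open>G\<close> with \<chi> colours. Each class is independent in
        \<open>G\<close>, hence lifts to an independent set of \<open>H\<close>; the bounds are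
        summed over the classes.\<close>
      obtain c' where c': "\<forall>u\<in>?V. c' u < \<chi>" "\<And>u v. adjacent G u v \<Longrightarrow> c' u \<noteq> c' v"
        using product_cover_exists[OF assms(1) \<chi>1] \<open>D \<chi>\<close> unfolding D_def by metis
      have "card {u \<in> ?V. c' u = i} \<le> independence_number H" for i
      proof (rule ge, rule degenerate_independent_set[OF assms(1) cov])
        fix T assume T: "T \<subseteq> {u \<in> ?V. c' u = i}" "T \<noteq> {}"
        then obtain y where "y \<in> T" by blast
        then have empty: "{u \<in> T. adjacent G y u} = {}" using T(1) c'(2)[of y] by auto
        have "card {u \<in> T. adjacent G y u} < t" unfolding empty using t by simp
        then show "\<exists>y\<in>T. card {u \<in> T. adjacent G y u} < t" using \<open>y \<in> T\<close> by blast
      qed auto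
      then have "(\<Sum>i<\<chi>. card {u \<in> ?V. c' u = i}) \<le> (\<Sum>i<\<chi>. independence_number H)"
        by (intro sum_mono)
      then show ?thesis using 2 sum_color_classes[OF finV c'(1)] by simp
    next
      case 3
      \<comment> \<open>Omitting class \<open>i\<close> leaves two classes, matching the fold number
        2.\<close>
      have "?n - card {u \<in> ?V. c u = i} \<le> independence_number H" if "i < 3" for i
      proof -
        have "card ({..<3} - {i}) = t" using that 3 by simp
        moreover have "c ` (?V - {u \<in> ?V. c u = i}) \<subseteq> {..<3} - {i}" using c(1) by auto
        ultimately have "card (?V - {u \<in> ?V. c u = i}) \<le> independence_number H"
          using cov by (intro ge indep[of "{..<3} - {i}" L]) auto
        then show ?thesis using finV by (simp add: card_Diff_subset)
      qed
      \<comment> \<open>Instead of selecting the two largest classes, the three bounds are added: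
        the left sides sum to \<open>3 * ?n - ?n = 2 * ?n\<close>.\<close>
      from this[of 0] this[of 1] this[of 2] show ?thesis
        using 3 sum_color_classes[OF finV c(1)] by (simp add: eval_nat_numeral)
    qed
  qed
  show ?thesis
    unfolding partially_dp_nice_def
  proof
    fix t assume "t \<in> {1..dp_chromatic_number G}"
    then have t: "1 \<le> t" "t \<le> \<chi>" by (auto simp: \<chi>_def)
    \<comment> \<open>Since a \<open>t\<close>-fold cover exists, the minimum is attained by some
      cover, to which \<open>bound\<close> applies.\<close>
    have "\<exists>k (L :: 'a \<Rightarrow> nat set) H. is_fold_cover t G L H \<and> independence_number H = k"
      using product_cover_exists[OF assms(1) t(1)] by blast
    then have "\<exists>(L :: 'a \<Rightarrow> nat set) H. is_fold_cover t G L H \<and>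
        independence_number H = partial_dp_chromatic_number t G"
      unfolding partial_dp_chromatic_number_def by (rule LeastI_ex)
    then have "t * ?n \<le> \<chi> * partial_dp_chromatic_number t G"
      using bound[OF t] by metis
    then have "real t * real ?n \<le> real \<chi> * real (partial_dp_chromatic_number t G)"
      by (metis of_nat_le_iff of_nat_mult)
    then show "real t * real ?n / real (dp_chromatic_number G)
        \<le> real (partial_dp_chromatic_number t G)"
      using \<chi>1 unfolding \<chi>_def[symmetric] by (simp add: divide_le_eq mult.commute)
  qed
qed

end
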